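(* Let $k$ be a unital integral domain of any characteristic, let $H(z)\in k\langle\langle z\rangle\rangle^{\times n}$ with $o(H(z))\ge 2$, let $F_t(z)=z-tH(z)$, and write the inverse map of $F_t(z)$ as $G_t(z)=z+tN_t(z)$ with $N_t(z)\in k[[t]]\langle\langle z\rangle\rangle^{\times n}$. Then $N_t(z)$ is a power series solution in $k[[t]]\langle\langle z\rangle\rangle^{\times n}$ of the following Cauchy problem in noncommutative variables: $$\frac{\partial N_t}{\partial t}=\left[N_t\frac{\partial}{\partial z}\right]N_t,\qquad N_{t=0}(z)=H(z).$$
   Context: $n\ge 1$; $z=(z_1,\dots,z_n)$ are noncommutative free variables; $t$ is a formal parameter commuting with $z$. Integral domains are commutative. $k\langle\langle z\rangle\rangle$ and $k[[t]]\langle\langle z\rangle\rangle$ are the algebras of formal power series in the noncommuting variables $z_i$ over $k$ and $k[[t]]$. The order $o(U)$ of a vector $U$ is the minimum of the orders (lowest degree in $z$) of its components. The inverse map $G_t$ of $F_t$ is the vector with $F_t(G_t(z))=z=G_t(F_t(z))$, where $u(F_t)$ denotes substitution of the components of $F_t$ for the $z_i$ (componentwise for vectors); it exists and is of the form $z+tN_t(z)$ with $o(N_t(z))\ge2$. For a vector $\vec u=(u_1,\dots,u_n)$ over $k[[t]]\langle\langle z\rangle\rangle$, $[\vec u\frac{\partial}{\partial z}]$ denotes the unique $k[[t]]$-derivation of $k[[t]]\langle\langle z\rangle\rangle$ sending $z_i$ to $u_i$ for all $i$; applied to a vector it acts componentwise. $\frac{\partial}{\partial t}$ acts coefficientwise,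 with $\frac{\partial z_i}{\partial t}=0$. *)

theory Defs
  imports
    "HOL-Analysis.Finite_Cartesian_Product"
    "HOL-Computational_Algebra.Formal_Power_Series"
    "HOL-Library.Extended_Nat"
begin

text \<open>
  Formal power series over \<open>'r\<close> in noncommuting variables indexed by \<open>'n\<close>, given by their
  coefficients: monomials are words, i.e. lists of variable indices, and multiply by
  concatenation.  For \<open>n \<ge> 1\<close> variables take \<open>'n\<close> to be a finite type with \<open>n\<close> elements
  (finite types are nonempty).
\<close>

typedef ('n, 'r) ncps = "UNIV :: ('n list \<Rightarrow> 'r) set"
  morphisms ncps_coeff Abs_ncps
  by simp

setup_lifting type_definition_ncps

lemma ncps_eq_iff: "u = v \<longleftrightarrow> (\<forall>w. ncps_coeff u w = ncps_coeff v w)"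
  by transfer auto

instantiation ncps :: (type, ab_group_add) ab_group_add
begin

lift_definition zero_ncps :: "('a, 'b) ncps" is "\<lambda>w. 0" .
lift_definition plus_ncps :: "('a, 'b) ncps \<Rightarrow> ('a, 'b) ncps \<Rightarrow> ('a, 'b) ncps"
  is "\<lambda>u v w. u w + v w" .
lift_definition minus_ncps :: "('a, 'b) ncps \<Rightarrow> ('a, 'b) ncps \<Rightarrow> ('a, 'b) ncps"
  is "\<lambda>u v w. u w - v w" .
lift_definition uminus_ncps :: "('a, 'b) ncps \<Rightarrow> ('a, 'b) ncps"
  is "\<lambda>u w. - u w" .

instance
  by standard (transfer; simp add: fun_eq_iff algebra_simps)+

end

lift_definition ncps_const :: "'r::zero \<Rightarrow> ('n, 'r) ncps"
  is "\<lambda>c w. if w = [] then c else 0" .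

lift_definition ncps_var :: "'n \<Rightarrow> ('n, 'r::zero_neq_one) ncps"
  is "\<lambda>i w. if w = [i] then 1 else 0" .

instantiation ncps :: (type, ring_1) ring_1
begin

definition one_ncps :: "('a, 'b) ncps" where
  "one_ncps = ncps_const 1"

lift_definition times_ncps :: "('a, 'b) ncps \<Rightarrow> ('a, 'b) ncps \<Rightarrow> ('a, 'b) ncps"
  is "\<lambda>u v w. \<Sum>i=0..length w. u (take i w) * v (drop i w)" .

instance
proof
  fix a b c :: "('a, 'b) ncps"
  show "(a + b) * c = a * c + b * c"
    by transfer (simp add: fun_eq_iff distrib_right sum.distrib)
  show "a * (b + c) = a * b + a * c"
    by transfer (simp add: fun_eq_iff distrib_left sum.distrib)
  show "(0 :: ('a, 'b) ncps) \<noteq> 1"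
    unfolding one_ncps_def by transfer (auto simp: fun_eq_iff)
  show "1 * a = a"
    unfolding one_ncps_def
  proof (transfer, rule ext)
    fix a :: "'a list \<Rightarrow> 'b" and w :: "'a list"
    have "(\<Sum>i=0..length w. (if take i w = [] then 1 else 0) * a (drop i w))
        = (\<Sum>i\<in>{0..length w}. if i = 0 then a w else 0)"
      by (rule sum.cong) auto
    then show "(\<Sum>i=0..length w. (if take i w = [] then 1 else 0) * a (drop i w)) = a w"
      by simp
  qed
  show "a * 1 = a"
    unfolding one_ncps_def
  proof (transfer, rule ext)
    fix a :: "'a list \<Rightarrow> 'b" and w :: "'a list"
    have "(\<Sum>i=0..length w. a (take i w) * (if drop i w = [] then 1 else 0))
        = (\<Sum>i\<in>{0..length w}. if i = length w then a w else 0)"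
      by (rule sum.cong) auto
    then show "(\<Sum>i=0..length w. a (take i w) * (if drop i w = [] then 1 else 0)) = a w"
      by simp
  qed
  show "a * b * c = a * (b * c)"
  proof (transfer, rule ext)
    fix a b c :: "'a list \<Rightarrow> 'b" and w :: "'a list"
    let ?n = "length w"
    define f where "f = (\<lambda>i j m. a (take i w) * b (take j (drop i w)) * c (drop (?n - m) w))"
    have "(\<Sum>j=0..?n. \<Sum>i=0..j. f i (j - i) (?n - j)) =
          (\<Sum>j=0..?n. \<Sum>i=0..?n - j. f j i (?n - j - i))"
      by (rule fps_mult_assoc_lemma)
    moreover have "(\<Sum>j=0..?n. \<Sum>i=0..j. f i (j - i) (?n - j)) =
      (\<Sum>j=0..?n. (\<Sum>i=0..length (take j w). a (take i (take j w)) * b (drop i (take j w)))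
         * c (drop j w))"
      unfolding sum_distrib_right f_def
      by (intro sum.cong refl) (auto simp: drop_take min_absorb1 min_absorb2)
    moreover have "(\<Sum>j=0..?n. \<Sum>i=0..?n - j. f j i (?n - j - i)) =
      (\<Sum>j=0..?n. a (take j w) *
         (\<Sum>i=0..length (drop j w). b (take i (drop j w)) * c (drop i (drop j w))))"
      unfolding sum_distrib_left f_def
      by (intro sum.cong refl) (auto simp: mult.assoc add.commute)
    ultimately show "(\<Sum>j=0..?n. (\<Sum>i=0..length (take j w).
         a (take i (take j w)) * b (drop i (take j w))) * c (drop j w)) =
      (\<Sum>j=0..?n. a (take j w) *
         (\<Sum>i=0..length (drop j w). b (take i (drop j w)) * c (drop i (drop j w))))"
      by simp
  qed
qed

end

lift_definition ncps_map :: "('r \<Rightarrow> 's) \<Rightarrow> ('n, 'r) ncps \<Rightarrow> ('n, 's) ncps"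
  is "\<lambda>f u w. f (u w)" .

definition zvec :: "('n, 'r::zero_neq_one) ncps ^ 'n" where
  "zvec = (\<chi> i. ncps_var i)"

definition ncvec_map :: "('r \<Rightarrow> 's) \<Rightarrow> ('n, 'r) ncps ^ 'm \<Rightarrow> ('n, 's) ncps ^ 'm" where
  "ncvec_map f U = (\<chi> i. ncps_map f (U $ i))"

text \<open>The zero series has order \<open>\<infinity>\<close> (the infimum of the empty set).\<close>

definition ncps_order :: "('n, 'r::zero) ncps \<Rightarrow> enat" where
  "ncps_order u = Inf {enat (length w) | w. ncps_coeff u w \<noteq> 0}"

definition ncvec_order :: "('n, 'r::zero) ncps ^ 'm \<Rightarrow> enat" where
  "ncvec_order U = Min (range (\<lambda>i. ncps_order (U $ i)))"

text \<open>
  Substitution \<open>u(F)\<close> of the components of \<open>F\<close> for the variables, where \<open>F\<close> has order at least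
  \<open>1\<close>: a word \<open>v\<close> then becomes a product of order at least \<open>length v\<close>, so that only
  the words with \<open>length v \<le> length w\<close> contribute to the coefficient at \<open>w\<close>.
\<close>

lift_definition ncps_subst :: "('n::finite, 'r::ring_1) ncps \<Rightarrow> ('n, 'r) ncps ^ 'n \<Rightarrow> ('n, 'r) ncps"
  is "\<lambda>u F w. \<Sum>v | length v \<le> length w.
        u v * ncps_coeff (prod_list (map (\<lambda>i. F $ i) v)) w" .

definition ncvec_subst ::
    "('n::finite, 'r::ring_1) ncps ^ 'm \<Rightarrow> ('n, 'r) ncps ^ 'n \<Rightarrow> ('n, 'r) ncps ^ 'm" where
  "ncvec_subst U F = (\<chi> i. ncps_subst (U $ i) F)"

text \<open>The order conditions make both substitutions meaningful.\<close>

definition is_inverse_map ::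
    "('n::finite, 'r::ring_1) ncps ^ 'n \<Rightarrow> ('n, 'r) ncps ^ 'n \<Rightarrow> bool" where
  "is_inverse_map F G \<longleftrightarrow>
     1 \<le> ncvec_order F \<and> 1 \<le> ncvec_order G \<and>
     ncvec_subst F G = zvec \<and> ncvec_subst G F = zvec"

definition is_derivation :: "(('n, 'r::comm_ring_1) ncps \<Rightarrow> ('n, 'r) ncps) \<Rightarrow> bool" where
  "is_derivation D \<longleftrightarrow>
     (\<forall>u v. D (u + v) = D u + D v) \<and>
     (\<forall>c u. D (ncps_const c * u) = ncps_const c * D u) \<and>
     (\<forall>u v. D (u * v) = D u * v + u * D v)"

definition derivation_of ::
    "('n::finite, 'r::comm_ring_1) ncps ^ 'n \<Rightarrow> ('n, 'r) ncps \<Rightarrow> ('n, 'r) ncps" where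
  "derivation_of U = (THE D. is_derivation D \<and> (\<forall>i. D (ncps_var i) = U $ i))"

definition derivation_vec ::
    "('n::finite, 'r::comm_ring_1) ncps ^ 'n \<Rightarrow> ('n, 'r) ncps ^ 'm \<Rightarrow> ('n, 'r) ncps ^ 'm" where
  "derivation_vec U V = (\<chi> i. derivation_of U (V $ i))"

text \<open>
  Over \<open>k[[t]] = 'k fps\<close> the parameter \<open>t\<close> is the constant series \<open>fps_X\<close>, the inclusion of
  series over \<open>k\<close> is coefficientwise \<open>fps_const\<close>, and differentiation in \<open>t\<close> and evaluation at
  \<open>t = 0\<close> are coefficientwise \<open>fps_deriv\<close> and \<open>fps_nth _ 0\<close>.
\<close>

definition tpar :: "('n, 'k::comm_ring_1 fps) ncps" where
  "tpar = ncps_const fps_X"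

definition t_embed :: "('n, 'k::comm_ring_1) ncps ^ 'm \<Rightarrow> ('n, 'k fps) ncps ^ 'm" where
  "t_embed = ncvec_map fps_const"

definition t_deriv :: "('n, 'k::comm_ring_1 fps) ncps ^ 'm \<Rightarrow> ('n, 'k fps) ncps ^ 'm" where
  "t_deriv = ncvec_map fps_deriv"

definition t_eval0 :: "('n, 'k::comm_ring_1 fps) ncps ^ 'm \<Rightarrow> ('n, 'k) ncps ^ 'm" where
  "t_eval0 = ncvec_map (\<lambda>c. fps_nth c 0)"

end

theory Submission
  imports Defs
begin

text \<open>
  Comparing \<open>F(G) = z\<close> with \<open>F = z - tH\<close> gives \<open>N = H(G)\<close>, which settles the initial
  condition since \<open>G = z\<close> at \<open>t = 0\<close>.  For the differential equation put
  \<open>E = \<partial>/\<partial>t - [N \<partial>/\<partial>z]\<close>, a derivation that kills the constants from \<open>k\<close>.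
  From \<open>G = z + tN\<close> one gets \<open>E G = t (E N)\<close>, whereas \<open>N = H(G)\<close> and the Leibniz rule
  put \<open>E N\<close> into the ideal generated by the components of \<open>E G\<close>.  Hence divisibility of
  \<open>E N\<close> by \<open>t\<^sup>m\<close> implies divisibility by \<open>t\<^sup>m\<^sup>+\<^sup>1\<close>, and so \<open>E N = 0\<close>.
\<close>

section \<open>Coefficients\<close>

lemma ncps_eqI: "(\<And>w. ncps_coeff u w = ncps_coeff v w) \<Longrightarrow> u = v"
  by (simp add: ncps_eq_iff)

lemma coeff_zero [simp]: "ncps_coeff 0 w = 0"
  by (simp add: zero_ncps.rep_eq)

lemma coeff_add [simp]: "ncps_coeff (u + v) w = ncps_coeff u w + ncps_coeff v w"
  by (simp add: plus_ncps.rep_eq)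

lemma coeff_diff [simp]: "ncps_coeff (u - v) w = ncps_coeff u w - ncps_coeff v w"
  by (simp add: minus_ncps.rep_eq)

lemma coeff_sum [simp]: "ncps_coeff (sum f A) w = (\<Sum>a\<in>A. ncps_coeff (f a) w)"
  by (induction A rule: infinite_finite_induct) auto

lemma coeff_one: "ncps_coeff 1 w = (if w = [] then 1 else 0)"
  by (simp add: one_ncps_def ncps_const.rep_eq)

lemma coeff_mult_Nil [simp]: "ncps_coeff (u * v) [] = ncps_coeff u [] * ncps_coeff v []"
  by (simp add: times_ncps.rep_eq)

lemma coeff_mult_Cons:
  "ncps_coeff (u * v) (x # w) = ncps_coeff u [] * ncps_coeff v (x # w)
     + (\<Sum>i=0..length w. ncps_coeff u (x # take i w) * ncps_coeff v (drop i w))"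
  by (simp add: times_ncps.rep_eq sum.atLeast0_atMost_Suc_shift del: sum.cl_ivl_Suc)

lemma coeff_const_mult [simp]: "ncps_coeff (ncps_const c * u) w = c * ncps_coeff u w"
  by (cases w) (simp_all add: coeff_mult_Cons ncps_const.rep_eq)

lemma coeff_mult_const [simp]:
  fixes u :: "('n, 'r::comm_ring_1) ncps"
  shows "ncps_coeff (u * ncps_const c) w = c * ncps_coeff u w"
proof -
  have "ncps_coeff (u * ncps_const c) w =
      (\<Sum>i\<in>{0..length w}. if i = length w then c * ncps_coeff u w else 0)"
    unfolding times_ncps.rep_eq
    by (rule sum.cong) (auto simp: ncps_const.rep_eq)
  then show ?thesis
    by simp
qed

lemma coeff_var_Nil [simp]: "ncps_coeff (ncps_var i) [] = 0"
  by (simp add: ncps_var.rep_eq)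

lemma coeff_var_mult_Nil [simp]: "ncps_coeff (ncps_var i * u) [] = 0"
  by simp

lemma coeff_var_mult_Cons [simp]:
  "ncps_coeff (ncps_var i * u) (x # w) = (if x = i then ncps_coeff u w else 0)"
proof -
  have "(\<Sum>j=0..length w. ncps_coeff (ncps_var i) (x # take j w) * ncps_coeff u (drop j w))
      = (\<Sum>j\<in>{0..length w}. if j = 0 then (if x = i then ncps_coeff u w else 0) else 0)"
    by (rule sum.cong) (auto simp: ncps_var.rep_eq)
  then show ?thesis
    by (simp add: coeff_mult_Cons ncps_var.rep_eq)
qed

lemma coeff_prod_var:
  "ncps_coeff (prod_list (map ncps_var v)) w = (if v = w then 1 else 0)"
proof (induction v arbitrary: w)
  case Nil
  then show ?case by (simp add: coeff_one)
next
  case (Cons x v)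
  then show ?case by (cases w) auto
qed

lemma coeff_map [simp]: "ncps_coeff (ncps_map f u) w = f (ncps_coeff u w)"
  by (simp add: ncps_map.rep_eq)

lemma finite_words_le: "finite {v :: 'n::finite list. length v \<le> m}"
  using finite_lists_length_le[of "UNIV :: 'n set" m] by simp

lemma coeff_subst:
  "ncps_coeff (ncps_subst u F) w =
     (\<Sum>v | length v \<le> length w. ncps_coeff u v * ncps_coeff (prod_list (map (\<lambda>i. F $ i) v)) w)"
  by (simp add: ncps_subst.rep_eq)

lemma coeff_Nil_of_order:
  assumes "1 \<le> ncvec_order U"
  shows "ncps_coeff (U $ i) [] = 0"
proof (rule ccontr)
  assume "ncps_coeff (U $ i) [] \<noteq> 0"
  then have "ncps_order (U $ i) \<le> enat 0"
    unfolding ncps_order_def by (intro Inf_lower) force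
  moreover have "ncvec_order U \<le> ncps_order (U $ i)"
    unfolding ncvec_order_def by (rule Min_le) auto
  ultimately show False
    using assms by (simp add: zero_enat_def[symmetric])
qed

text \<open>Every factor has zero constant term and so takes up at least one letter of
  \<open>w\<close>. This allows the finite sum defining a substitution to be extended by longer
  words.\<close>

lemma coeff_prod_low:
  assumes "\<And>i. ncps_coeff (f i) [] = 0" and "length w < length v"
  shows "ncps_coeff (prod_list (map f v)) w = 0"
  using assms(2)
proof (induction v arbitrary: w)
  case (Cons x v)
  show ?case
  proof (cases w)
    case Nil
    then show ?thesis using assms(1) by simp
  next
    case (Cons y w')
    with Cons.prems Cons.IH show ?thesis
      by (auto simp: coeff_mult_Cons assms(1) intro!: sum.neutral)
  qed
qed simp

section \<open>Existence and uniqueness of derivations with prescribed values\<close>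

text \<open>Left quotient by the letter \<open>x\<close>; it supplies the tails \<open>u_i\<close>
  in the decomposition of \<open>u\<close> as a constant plus the sum of the
  \<open>z_i u_i\<close>.\<close>

lift_definition ncps_shift :: "'n \<Rightarrow> ('n, 'r) ncps \<Rightarrow> ('n, 'r) ncps"
  is "\<lambda>x u w. u (x # w)" .

lemma coeff_shift [simp]: "ncps_coeff (ncps_shift x u) w = ncps_coeff u (x # w)"
  by (simp add: ncps_shift.rep_eq)

lemma ncps_decomp:
  fixes u :: "('n::finite, 'r::ring_1) ncps"
  shows "u = ncps_const (ncps_coeff u []) + (\<Sum>i\<in>UNIV. ncps_var i * ncps_shift i u)"
proof (rule ncps_eqI)
  fix w
  show "ncps_coeff u w = ncps_coeff (ncps_const (ncps_coeff u [])
      + (\<Sum>i\<in>UNIV. ncps_var i * ncps_shift i u)) w"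
    by (cases w) (simp_all add: ncps_const.rep_eq)
qed

lemma shift_add: "ncps_shift x (u + v) = ncps_shift x u + ncps_shift x v"
  by (rule ncps_eqI) simp

lemma shift_const_mult: "ncps_shift x (ncps_const c * u) = ncps_const c * ncps_shift x u"
  by (rule ncps_eqI) simp

text \<open>The first letter of a word in \<open>u * v\<close> comes from \<open>u\<close>, or from
  \<open>v\<close> when the prefix taken from \<open>u\<close> is empty.\<close>

lemma shift_mult:
  "ncps_shift x (u * v) = ncps_shift x u * v + ncps_const (ncps_coeff u []) * ncps_shift x v"
  by (rule ncps_eqI) (simp add: coeff_mult_Cons times_ncps.rep_eq[of "ncps_shift x u" v])

text \<open>
  Writing \<open>u = c + (\<Sum>i. z\<^sub>i u\<^sub>i)\<close>, a derivation with values \<open>U\<^sub>i\<close> has to satisfy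
  \<open>D u = (\<Sum>i. U\<^sub>i u\<^sub>i + z\<^sub>i D u\<^sub>i)\<close>.  This determines the coefficients of \<open>D u\<close> by recursion
  on the word.
\<close>

primrec der_coeff ::
    "('n::finite, 'r::comm_ring_1) ncps ^ 'n \<Rightarrow> 'n list \<Rightarrow> ('n, 'r) ncps \<Rightarrow> 'r" where
  "der_coeff U [] u = ncps_coeff (\<Sum>i\<in>UNIV. U $ i * ncps_shift i u) []"
| "der_coeff U (x # w) u = ncps_coeff (\<Sum>i\<in>UNIV. U $ i * ncps_shift i u) (x # w)
     + der_coeff U w (ncps_shift x u)"

lift_definition der ::
    "('n::finite, 'r::comm_ring_1) ncps ^ 'n \<Rightarrow> ('n, 'r) ncps \<Rightarrow> ('n, 'r) ncps"
  is "\<lambda>U u w. der_coeff U w u" .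

lemma der_rec:
  "der U u = (\<Sum>i\<in>UNIV. U $ i * ncps_shift i u) + (\<Sum>i\<in>UNIV. ncps_var i * der U (ncps_shift i u))"
proof (rule ncps_eqI)
  fix w
  show "ncps_coeff (der U u) w = ncps_coeff ((\<Sum>i\<in>UNIV. U $ i * ncps_shift i u)
      + (\<Sum>i\<in>UNIV. ncps_var i * der U (ncps_shift i u))) w"
    by (cases w) (simp_all add: der.rep_eq)
qed

lemma coeff_der_Nil:
  "ncps_coeff (der U u) [] = ncps_coeff (\<Sum>i\<in>UNIV. U $ i * ncps_shift i u) []"
  by (simp add: der.rep_eq)

lemma coeff_der_Cons:
  "ncps_coeff (der U u) (x # w) = ncps_coeff (\<Sum>i\<in>UNIV. U $ i * ncps_shift i u) (x # w)
     + ncps_coeff (der U (ncps_shift x u)) w"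
  by (simp add: der.rep_eq)

lemma der_add: "der U (u + v) = der U u + der U v"
proof (rule ncps_eqI)
  fix w
  show "ncps_coeff (der U (u + v)) w = ncps_coeff (der U u + der U v) w"
    by (induction w arbitrary: u v)
      (simp_all add: coeff_der_Nil coeff_der_Cons shift_add distrib_left sum.distrib)
qed

lemma mult_const_left_commute:
  fixes u v :: "('n, 'r::comm_ring_1) ncps"
  shows "u * (ncps_const c * v) = ncps_const c * (u * v)"
proof -
  have "u * ncps_const c = ncps_const c * u"
    by (rule ncps_eqI) simp
  then show ?thesis
    by (metis mult.assoc)
qed

lemma der_const_mult: "der U (ncps_const c * u) = ncps_const c * der U u"
proof (rule ncps_eqI)
  fix w
  show "ncps_coeff (der U (ncps_const c * u)) w = ncps_coeff (ncps_const c * der U u) w"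
    by (induction w arbitrary: u)
      (simp_all add: coeff_der_Nil coeff_der_Cons shift_const_mult mult_const_left_commute
        sum_distrib_left distrib_left mult.left_commute)
qed

text \<open>The Leibniz defect of \<open>u\<close> and \<open>v\<close> is the sum of
  \<open>z_i\<close> times the defect of \<open>u_i\<close> and \<open>v\<close>: the terms with
  \<open>U $ i\<close> and with the constant term of \<open>u\<close> cancel. So it has no constant
  term, and its other coefficients vanish by induction on the word.\<close>

lemma der_mult: "der U (u * v) = der U u * v + u * der U v"
proof (rule ncps_eqI)
  fix w
  have rec: "der U (u * v) - (der U u * v + u * der U v) =
      (\<Sum>i\<in>UNIV. ncps_var i * (der U (ncps_shift i u * v)
         - (der U (ncps_shift i u) * v + ncps_shift i u * der U v)))" for u v
  proof -
    let ?c = "ncps_const (ncps_coeff u [])"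
    have 1: "der U (u * v) = (\<Sum>i\<in>UNIV. U $ i * ncps_shift i u * v)
        + (\<Sum>i\<in>UNIV. ncps_var i * der U (ncps_shift i u * v)) + ?c * der U v"
      unfolding der_rec[of U "u * v"] der_rec[of U v] shift_mult der_add der_const_mult
      by (simp add: distrib_left sum.distrib sum_distrib_left mult_const_left_commute mult.assoc)
    have 2: "der U u * v = (\<Sum>i\<in>UNIV. U $ i * ncps_shift i u * v)
        + (\<Sum>i\<in>UNIV. ncps_var i * (der U (ncps_shift i u) * v))"
      by (subst der_rec[of U u]) (simp add: distrib_right sum_distrib_right mult.assoc)
    have 3: "u * der U v = ?c * der U v + (\<Sum>i\<in>UNIV. ncps_var i * (ncps_shift i u * der U v))"
      by (subst ncps_decomp[of u]) (simp add: distrib_right sum_distrib_right mult.assoc)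
    show ?thesis
      unfolding 1 2 3 by (simp add: algebra_simps sum.distrib sum_subtractf)
  qed
  have "ncps_coeff (der U (u * v) - (der U u * v + u * der U v)) w = 0"
  proof (induction w arbitrary: u)
    case Nil
    then show ?case unfolding rec[of u v] by simp
  next
    case (Cons x w)
    from Cons[of "ncps_shift x u"] show ?case
      unfolding rec[of u v] by (simp del: coeff_diff coeff_add)
  qed
  then show "ncps_coeff (der U (u * v)) w = ncps_coeff (der U u * v + u * der U v) w"
    by simp
qed

lemma is_derivation_der: "is_derivation (der U)"
  unfolding is_derivation_def using der_add der_const_mult der_mult by blast

lemma is_derivation_const:
  assumes "is_derivation D"
  shows "D (ncps_const c) = 0"
proof -
  have "D (1 * 1) = D 1 * 1 + 1 * D 1"
    using assms unfolding is_derivation_def by blast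
  then have "D 1 = 0"
    by simp
  moreover have "D (ncps_const c * 1) = ncps_const c * D 1"
    using assms unfolding is_derivation_def by blast
  ultimately show ?thesis
    by simp
qed

lemma additive_sum:
  fixes D :: "'a::ab_group_add \<Rightarrow> 'b::ab_group_add"
  assumes "\<And>u v. D (u + v) = D u + D v"
  shows "D (sum f A) = (\<Sum>a\<in>A. D (f a))"
proof -
  have "D 0 = 0"
    using assms[of 0 0] by simp
  then show ?thesis
    by (induction A rule: infinite_finite_induct) (auto simp: assms)
qed

lemma is_derivation_rec:
  fixes u :: "('n::finite, 'r::comm_ring_1) ncps"
  assumes "is_derivation D"
  shows "D u = (\<Sum>i\<in>UNIV. D (ncps_var i) * ncps_shift i u)
    + (\<Sum>i\<in>UNIV. ncps_var i * D (ncps_shift i u))"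
proof -
  have add: "D (u + v) = D u + D v" and mult: "D (u * v) = D u * v + u * D v" for u v
    using assms unfolding is_derivation_def by blast+
  show ?thesis
    by (subst ncps_decomp[of u])
      (simp add: add mult additive_sum[of D] is_derivation_const[OF assms] sum.distrib)
qed

text \<open>By the recursion, the coefficient of \<open>D u\<close> at \<open>x # w\<close> involves
  \<open>D\<close> only through the values \<open>U $ i\<close> and through
  \<open>D (ncps_shift x u)\<close> at the shorter word \<open>w\<close>.\<close>

lemma is_derivation_unique:
  assumes "is_derivation D" and "\<And>i. D (ncps_var i) = U $ i"
  shows "D = der U"
proof (intro ext ncps_eqI)
  fix u w
  show "ncps_coeff (D u) w = ncps_coeff (der U u) w"
  proof (induction w arbitrary: u)
    case Nil
    then show ?case
      by (subst is_derivation_rec[OF assms(1)]) (simp add: assms(2) coeff_der_Nil)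
  next
    case (Cons x w)
    then show ?case
      by (subst is_derivation_rec[OF assms(1)]) (simp add: assms(2) coeff_der_Cons)
  qed
qed

text \<open>The tail of \<open>z_i\<close> after the letter \<open>j\<close> is the constant 1 if
  \<open>j = i\<close> and 0 otherwise, and derivations kill constants.\<close>

lemma der_var: "der U (ncps_var i) = U $ i"
proof (rule ncps_eqI)
  fix w
  have shift: "ncps_shift j (ncps_var i) = ncps_const (if j = i then 1 else 0 :: 'b)" for j :: 'a
    by (rule ncps_eqI) (simp add: ncps_var.rep_eq ncps_const.rep_eq)
  have "der U (ncps_var i) = (\<Sum>j\<in>UNIV. U $ j * ncps_const (if j = i then 1 else 0))"
    by (subst der_rec) (simp only: shift is_derivation_const[OF is_derivation_der] mult_zero_right
        sum.neutral_const add_0_right)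
  then show "ncps_coeff (der U (ncps_var i)) w = ncps_coeff (U $ i) w"
    by (simp only: coeff_sum coeff_mult_const if_distribR mult_1_left mult_zero_left)
      (simp add: if_distrib[of "\<lambda>c. c * _"] cong: if_cong)
qed

lemma derivation_of_eq_der: "derivation_of U = der U"
  unfolding derivation_of_def
  by (rule the_equality) (auto simp: is_derivation_der der_var intro: is_derivation_unique)

text \<open>Without constant terms in \<open>U\<close>, the derivation cannot lower the order. This
  stands in for continuity: a coefficient of the image at \<open>w\<close> depends only on
  coefficients at words no longer than \<open>w\<close>.\<close>

lemma coeff_der_low:
  assumes "\<And>i. ncps_coeff (U $ i) [] = 0"
    and "\<And>v. length v \<le> length w \<Longrightarrow> ncps_coeff u v = 0"
  shows "ncps_coeff (der U u) w = 0"
  using assms(2)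
proof (induction w arbitrary: u)
  case Nil
  then show ?case
    by (simp add: coeff_der_Nil assms(1))
next
  case (Cons x w)
  have "ncps_coeff (U $ i * ncps_shift i u) (x # w) = 0" for i
    using Cons.prems by (auto simp: coeff_mult_Cons assms(1) intro!: sum.neutral)
  moreover have "ncps_coeff (der U (ncps_shift x u)) w = 0"
    using Cons.prems by (intro Cons.IH) simp
  ultimately show ?case
    by (simp add: coeff_der_Cons)
qed

section \<open>Differentiation in the parameter and evaluation at zero\<close>

lemma map_deriv_mult:
  fixes u v :: "('n, 'k::comm_ring_1 fps) ncps"
  shows "ncps_map fps_deriv (u * v) = ncps_map fps_deriv u * v + u * ncps_map fps_deriv v"
  by (rule ncps_eqI)
    (simp add: times_ncps.rep_eq ncps_map.rep_eq fps_deriv_sum sum.distrib[symmetric] add.commute mult.commute)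

lemma map_nth0_mult:
  fixes u v :: "('n, 'k::comm_ring_1 fps) ncps"
  shows "ncps_map (\<lambda>c. fps_nth c 0) (u * v) =
    ncps_map (\<lambda>c. fps_nth c 0) u * ncps_map (\<lambda>c. fps_nth c 0) v"
  by (rule ncps_eqI) (simp add: times_ncps.rep_eq ncps_map.rep_eq fps_sum_nth)

lemma map_nth0_prod:
  fixes f :: "'a \<Rightarrow> ('n, 'k::comm_ring_1 fps) ncps"
  shows "ncps_map (\<lambda>c. fps_nth c 0) (prod_list (map f v)) =
    prod_list (map (\<lambda>i. ncps_map (\<lambda>c. fps_nth c 0) (f i)) v)"
proof (induction v)
  case Nil
  show ?case by (rule ncps_eqI) (simp add: coeff_one)
next
  case (Cons x v)
  then show ?case by (simp add: map_nth0_mult)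
qed

lemma fps_eq_0_if_X_power_dvd:
  fixes c :: "'k::comm_ring_1 fps"
  assumes "\<And>m. fps_X ^ m dvd c"
  shows "c = 0"
proof (rule fps_ext)
  fix n
  from assms[of "Suc n"] obtain q where "c = fps_X ^ Suc n * q"
    by (elim dvdE)
  then show "fps_nth c n = fps_nth 0 n"
    by (simp add: fps_X_power_mult_nth del: power_Suc)
qed

text \<open>Coefficientwise, because divisibility in the ring of noncommutative series is one-sided.\<close>

definition ncps_cdvd :: "'r::comm_ring_1 \<Rightarrow> ('n, 'r) ncps \<Rightarrow> bool" where
  "ncps_cdvd c u \<longleftrightarrow> (\<forall>w. c dvd ncps_coeff u w)"

lemma ncps_cdvd_add: "ncps_cdvd c u \<Longrightarrow> ncps_cdvd c v \<Longrightarrow> ncps_cdvd c (u + v)"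
  by (simp add: ncps_cdvd_def)

lemma ncps_cdvd_mult1: "ncps_cdvd c u \<Longrightarrow> ncps_cdvd c (u * v)"
  by (auto simp: ncps_cdvd_def times_ncps.rep_eq intro!: dvd_sum)

lemma ncps_cdvd_mult2: "ncps_cdvd c v \<Longrightarrow> ncps_cdvd c (u * v)"
  by (auto simp: ncps_cdvd_def times_ncps.rep_eq intro!: dvd_sum)

text \<open>By the Leibniz rule, each summand of \<open>E\<close> applied to a product contains one
  factor \<open>E (f i)\<close>.\<close>

lemma ncps_cdvd_derivation_prod:
  fixes E :: "('n, 'r::comm_ring_1) ncps \<Rightarrow> ('n, 'r) ncps"
  assumes mult: "\<And>u v. E (u * v) = E u * v + u * E v"
    and f: "\<And>i. ncps_cdvd c (E (f i))"
  shows "ncps_cdvd c (E (prod_list (map f v)))"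
proof (induction v)
  case Nil
  have "E 1 = 0"
    using mult[of 1 1] by simp
  then show ?case by (simp add: ncps_cdvd_def)
next
  case (Cons x v)
  then show ?case
    by (simp add: mult f ncps_cdvd_add ncps_cdvd_mult1 ncps_cdvd_mult2)
qed

section \<open>The Cauchy problem\<close>

text \<open>Substituting \<open>G\<close> into \<open>z_i - t H_i\<close> gives
  \<open>z_i = G_i - t H_i(G)\<close>. Comparison with \<open>G_i = z_i + t N_i\<close> leaves a
  factor \<open>t\<close>, which cancels in the integral domain \<open>k[[t]]\<close>.\<close>

lemma inverse_map_fixpoint:
  fixes H :: "('n::finite, 'k::idom) ncps ^ 'n" and F G N :: "('n, 'k fps) ncps ^ 'n"
  assumes "F = zvec - tpar *s t_embed H" "is_inverse_map F G" "G = zvec + tpar *s N"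
  shows "N $ i = ncps_subst (t_embed H $ i) G"
proof (rule ncps_eqI)
  fix w
  let ?P = "\<lambda>v. ncps_coeff (prod_list (map (\<lambda>i. G $ i) v)) w"
  let ?W = "{v :: 'n list. length v \<le> length w}"
  have G0: "ncps_coeff (G $ i) [] = 0" for i
    using assms(2) by (auto simp: is_inverse_map_def intro: coeff_Nil_of_order)
  have "ncps_subst (F $ i) G = ncps_var i"
    using assms(2) by (simp add: is_inverse_map_def ncvec_subst_def zvec_def vec_eq_iff)
  then have "ncps_coeff (ncps_var i) w = (\<Sum>v\<in>?W. ncps_coeff (F $ i) v * ?P v)"
    by (simp flip: coeff_subst)
  also have "\<dots> = (\<Sum>v\<in>?W. if v = [i] then ?P v else 0)
      - fps_X * ncps_coeff (ncps_subst (t_embed H $ i) G) w"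
    unfolding coeff_subst sum_distrib_left sum_subtractf[symmetric]
    by (rule sum.cong)
      (simp_all add: assms(1) zvec_def tpar_def ncps_var.rep_eq left_diff_distrib mult.assoc)
  \<comment> \<open>For empty \<open>w\<close> the word \<open>[i]\<close> lies outside
    \<open>?W\<close>; both sides are then zero because \<open>G\<close> has no constant
    term.\<close>
  also have "(\<Sum>v\<in>?W. if v = [i] then ?P v else 0) = ncps_coeff (G $ i) w"
    by (cases w) (simp_all add: finite_words_le G0)
  also have "\<dots> = ncps_coeff (ncps_var i) w + fps_X * ncps_coeff (N $ i) w"
    by (simp add: assms(3) zvec_def tpar_def)
  finally show "ncps_coeff (N $ i) w = ncps_coeff (ncps_subst (t_embed H $ i) G) w"
    by simp
qed

theorem theorem4p3:
  fixes H :: "('n::finite, 'k::idom) ncps ^ 'n"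
    and F G N :: "('n, 'k fps) ncps ^ 'n"
  assumes "ncvec_order H \<ge> 2"
    and "F = zvec - tpar *s t_embed H"
    and "is_inverse_map F G"
    and "G = zvec + tpar *s N"
  shows "t_deriv N = derivation_vec N N \<and> t_eval0 N = H"
proof
  have G: "G $ i = ncps_var i + ncps_const fps_X * N $ i" for i
    by (simp add: assms(4) zvec_def tpar_def)
  have G0: "ncps_coeff (G $ i) [] = 0" for i
    using assms(3) by (auto simp: is_inverse_map_def intro: coeff_Nil_of_order)
  have N0: "ncps_coeff (N $ i) [] = 0" for i
    using G0[of i] by (simp add: G del: coeff_mult_Nil)
  let ?P = "\<lambda>v. prod_list (map (\<lambda>i. G $ i) v)"
  have N: "ncps_coeff (N $ i) w =
      (\<Sum>v | length v \<le> length w. fps_const (ncps_coeff (H $ i) v) * ncps_coeff (?P v) w)" for i w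
    by (subst inverse_map_fixpoint[OF assms(2-4)])
      (simp add: coeff_subst t_embed_def ncvec_map_def)
  show "t_eval0 N = H"
  proof (subst vec_eq_iff, intro allI ncps_eqI)
    fix i w
    \<comment> \<open>At \<open>t = 0\<close> the map \<open>G\<close> is the identity, so the
      product along \<open>v\<close> becomes the monomial \<open>v\<close> itself.\<close>
    have "ncps_map (\<lambda>c. fps_nth c 0) (G $ j) = ncps_var j" for j
      by (rule ncps_eqI) (simp add: G ncps_var.rep_eq)
    then have "fps_nth (ncps_coeff (?P v) w) 0 = (if v = w then 1 else 0)" for v
      using map_nth0_prod[of "\<lambda>i. G $ i" v] coeff_prod_var[of v w]
      by (simp flip: coeff_map[where f = "\<lambda>c. fps_nth c 0"])
    then show "ncps_coeff (t_eval0 N $ i) w = ncps_coeff (H $ i) w"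
      by (simp add: t_eval0_def ncvec_map_def N fps_sum_nth finite_words_le
          if_distrib[of "(*) _"] cong: if_cong)
  qed
  define E where "E u = ncps_map fps_deriv u - der N u" for u
  have E_add: "E (u + v) = E u + E v" for u v
    unfolding E_def der_add by (rule ncps_eqI) simp
  have E_mult: "E (u * v) = E u * v + u * E v" for u v
    unfolding E_def der_mult map_deriv_mult by (simp add: algebra_simps)
  \<comment> \<open>Scalars from \<open>k\<close> suffice, as the coefficients of \<open>H\<close>
    lie there; \<open>fps_deriv\<close> annihilates them.\<close>
  have E_const: "E (ncps_const (fps_const c) * u) = ncps_const (fps_const c) * E u" for c u
    unfolding E_def der_const_mult by (rule ncps_eqI) (simp add: algebra_simps)
  have E_low: "ncps_coeff (E u) w = 0"
    if "\<And>v. length v \<le> length w \<Longrightarrow> ncps_coeff u v = 0" for u w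
    using that by (simp add: E_def coeff_der_low[OF N0])
  \<comment> \<open>\<open>E z_i = - N_i\<close> cancels the term \<open>N_i\<close> that arises
    from differentiating the factor \<open>t\<close> in \<open>t N_i\<close>.\<close>
  have E_G: "E (G $ i) = ncps_const fps_X * E (N $ i)" for i
    unfolding E_def G der_add der_const_mult der_var
    by (rule ncps_eqI) (simp add: ncps_var.rep_eq algebra_simps)
  have "ncps_cdvd (fps_X ^ m) (E (N $ i))" for m i
  proof (induction m arbitrary: i)
    case 0
    then show ?case by (simp add: ncps_cdvd_def)
  next
    case (Suc m)
    \<comment> \<open>The factor \<open>fps_X\<close> in \<open>E_G\<close> supplies the additional
      power of \<open>t\<close>.\<close>
    then have "ncps_cdvd (fps_X ^ Suc m) (E (G $ j))" for j
      by (simp add: E_G ncps_cdvd_def mult_dvd_mono)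
    then have P: "ncps_cdvd (fps_X ^ Suc m) (E (?P v))" for v
      by (rule ncps_cdvd_derivation_prod[where E = E, OF E_mult])
    show ?case
      unfolding ncps_cdvd_def
    proof
      fix w :: "'n list"
      let ?W = "{v :: 'n list. length v \<le> length w}"
      \<comment> \<open>\<open>E\<close> is applied to a finite truncation of \<open>H(G)\<close>,
        chosen according to \<open>w\<close>: the remainder \<open>N $ i - S\<close> has no terms of
        degree up to \<open>length w\<close>, so its image under \<open>E\<close> vanishes at
        \<open>w\<close>.\<close>
      define S where "S = (\<Sum>v\<in>?W. ncps_const (fps_const (ncps_coeff (H $ i) v)) * ?P v)"
      have "ncps_coeff (N $ i - S) x = 0" if "length x \<le> length w" for x
      proof -
        \<comment> \<open>For \<open>x\<close> shorter than \<open>w\<close>, the sum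
          \<open>S\<close> runs over more words than the formula for \<open>N\<close>; the surplus
          products vanish at \<open>x\<close>.\<close>
        have "ncps_coeff S x = ncps_coeff (N $ i) x"
          unfolding S_def N coeff_sum coeff_const_mult
          using that by (intro sum.mono_neutral_right finite_words_le)
            (auto simp: coeff_prod_low[OF G0])
        then show ?thesis
          by simp
      qed
      then have "ncps_coeff (E (N $ i - S)) w = 0"
        by (rule E_low)
      moreover have "E (N $ i) = E (N $ i - S) + E S"
        by (simp flip: E_add)
      ultimately have "ncps_coeff (E (N $ i)) w = ncps_coeff (E S) w"
        by simp
      also have "fps_X ^ Suc m dvd \<dots>"
        unfolding S_def additive_sum[of E, OF E_add] E_const coeff_sum coeff_const_mult
        using P by (intro dvd_sum dvd_mult) (simp add: ncps_cdvd_def)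
      finally show "fps_X ^ Suc m dvd ncps_coeff (E (N $ i)) w" .
    qed
  qed
  then have "E (N $ i) = 0" for i
    by (intro ncps_eqI) (auto simp: ncps_cdvd_def intro: fps_eq_0_if_X_power_dvd)
  then show "t_deriv N = derivation_vec N N"
    by (simp add: vec_eq_iff t_deriv_def ncvec_map_def derivation_vec_def derivation_of_eq_der E_def)
qed

end
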